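(* Let $H_1$ and $H_2$ be two numerical semigroups such that $H_1$ or $H_2$ is not symmetric. Then no gluing $H=\langle xH_1,yH_2\rangle$ of $H_1$ and $H_2$ is almost symmetric.
   Context: A numerical semigroup is a subset $H\subseteq\mathbb{N}=\{0,1,2,\dots\}$ containing $0$, closed under addition, with $\mathbb{N}\setminus H$ finite. Let $\mathrm{g}(H)=|\mathbb{N}\setminus H|$, let $\mathrm{F}(H)$ be the largest integer not in $H$ (so $\mathrm{F}(\mathbb{N})=-1$), let $\mathrm{PF}(H)=\{x\in\mathbb{Z}\setminus H \mid x+h\in H\text{ for all }h\in H,\ h\neq 0\}$ and $\mathrm{t}(H)=|\mathrm{PF}(H)|$. $H$ is symmetric if $2\mathrm{g}(H)=\mathrm{F}(H)+1$ (equivalently $\mathrm{t}(H)=1$), and almost symmetric if $2\mathrm{g}(H)=\mathrm{F}(H)+\mathrm{t}(H)$. Gluing: let $H_1=\langle a_1,\dots,a_n\rangle$ and $H_2=\langle b_1,\dots,b_m\rangle$ be numerical semigroups given by their minimal generators; take $y\in H_1\setminus\{a_1,\dots,a_n\}$ and $x\in H_2\setminus\{b_1,\dots,b_m\}$ with $\gcd(x,y)=1$. Then $H=\langle xH_1,yH_2\rangle=\langle xa_1,\dots,xa_n,yb_1,\dots,yb_m\rangle$ is called a gluing of $H_1$ and $H_2$. *)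

theory Defs
  imports Main "HOL.Hull"
begin

definition add_submonoid :: "nat set \<Rightarrow> bool" where
  "add_submonoid M \<longleftrightarrow> 0 \<in> M \<and> (\<forall>a\<in>M. \<forall>b\<in>M. a + b \<in> M)"

definition numerical_semigroup :: "nat set \<Rightarrow> bool" where
  "numerical_semigroup H \<longleftrightarrow> add_submonoid H \<and> finite (- H)"

definition generated :: "nat set \<Rightarrow> nat set" where
  "generated A = add_submonoid hull A"

definition minimal_generators :: "nat set \<Rightarrow> nat set \<Rightarrow> bool" where
  "minimal_generators H A \<longleftrightarrow> generated A = H \<and> (\<forall>B. B \<subset> A \<longrightarrow> generated B \<noteq> H)"

definition genus :: "nat set \<Rightarrow> nat" where
  "genus H = card (- H)"

text \<open>The Frobenius number ranges over the integers, so that it is \<open>-1\<close> for \<open>H = UNIV\<close>.\<close>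

definition Frobenius :: "nat set \<Rightarrow> int" where
  "Frobenius H = (GREATEST z. z \<notin> int ` H)"

definition PF :: "nat set \<Rightarrow> int set" where
  "PF H = {z. z \<notin> int ` H \<and> (\<forall>h\<in>H. h \<noteq> 0 \<longrightarrow> z + int h \<in> int ` H)}"

definition semigroup_type :: "nat set \<Rightarrow> nat" where
  "semigroup_type H = card (PF H)"

definition symmetric :: "nat set \<Rightarrow> bool" where
  "symmetric H \<longleftrightarrow> 2 * int (genus H) = Frobenius H + 1"

definition almost_symmetric :: "nat set \<Rightarrow> bool" where
  "almost_symmetric H \<longleftrightarrow> 2 * int (genus H) = Frobenius H + int (semigroup_type H)"

text \<open>A numerical semigroup has exactly one minimal generating set (its nonzero elements that
  are not sums of two nonzero elements), so \<open>A\<close> and \<open>B\<close> below are determined by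
  \<open>H1\<close> and \<open>H2\<close>. The case \<open>y = 0\<close> is excluded: it would force \<open>x = 1\<close>, which is a minimal
  generator whenever it lies in \<open>H2\<close>; symmetrically for \<open>x = 0\<close>.\<close>

definition is_gluing :: "nat set \<Rightarrow> nat \<Rightarrow> nat set \<Rightarrow> nat \<Rightarrow> nat set \<Rightarrow> bool" where
  "is_gluing H x H1 y H2 \<longleftrightarrow>
     numerical_semigroup H1 \<and> numerical_semigroup H2 \<and>
     (\<exists>A B. minimal_generators H1 A \<and> minimal_generators H2 B \<and>
            y \<in> H1 - A \<and> x \<in> H2 - B) \<and>
     gcd x y = 1 \<and>
     H = generated ((*) x ` H1 \<union> (*) y ` H2)"

end

theory Submission
  imports Defs
begin

text \<open>
  Let \<open>L(H)\<close> be the set of integers \<open>z\<close> such that neither \<open>z\<close> nor \<open>F(H) - z\<close> lies in \<open>H\<close>.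
  Counting \<open>{0..F(H)}\<close> with the reflection \<open>z \<mapsto> F(H) - z\<close> gives \<open>2 g(H) = F(H) + 1 + |L(H)|\<close>.
  Hence \<open>H\<close> is symmetric iff \<open>L(H)\<close> is empty and, since \<open>PF(H) - {F(H)} \<subseteq> L(H)\<close>, it is almost
  symmetric iff \<open>L(H) \<subseteq> PF(H)\<close>.

  For a gluing, \<open>F(H) = x F(H1) + y w\<close> with \<open>w = F(H2) + x\<close>. Since \<open>w\<close> lies in the Apery set of
  \<open>H2\<close> with respect to \<open>x\<close>, \<open>x u + y w \<in> H\<close> forces \<open>u \<in> H1\<close>, and so does \<open>x u \<in> H\<close>.
  If \<open>H1\<close> is not symmetric and \<open>a \<in> L(H1)\<close>, then \<open>x a \<in> L(H)\<close>, but \<open>x a + y w \<notin> H\<close> although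
  \<open>y w\<close> is a nonzero element of \<open>H\<close>, so that \<open>x a \<notin> PF(H)\<close>.
\<close>

section \<open>The Frobenius number over the integers\<close>

lemma Frobenius_eqI:
  assumes "F \<notin> int ` H" and "\<And>z. z > F \<Longrightarrow> z \<in> int ` H"
  shows "Frobenius H = F"
  unfolding Frobenius_def
proof (rule Greatest_equality)
  show "F \<notin> int ` H" by fact
  show "z \<le> F" if "z \<notin> int ` H" for z
    using assms(2)[of z] that by force
qed

lemma ex_Frobenius:
  assumes "finite (- H)"
  shows "\<exists>F. F \<notin> int ` H \<and> (\<forall>z>F. z \<in> int ` H)"
proof -
  \<comment> \<open>The extra element \<open>-1\<close> keeps the set nonempty and gives the right
    maximum when \<open>H\<close> has no gaps.\<close>
  let ?G = "insert (-1) (int ` (- H))"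
  have fin: "finite ?G" using assms by simp
  have "Max ?G \<in> ?G" using fin by (intro Max_in) auto
  then have "Max ?G \<notin> int ` H" by auto
  moreover have "z \<in> int ` H" if z: "z > Max ?G" for z
  proof (rule ccontr)
    assume n: "z \<notin> int ` H"
    have "-1 \<le> Max ?G" using fin by (intro Max_ge) auto
    with z have "z = int (nat z)" by simp
    with n have "z \<in> ?G" by (metis ComplI image_eqI insertI2)
    then have "z \<le> Max ?G" using fin by (intro Max_ge)
    with z show False by simp
  qed
  ultimately show ?thesis by blast
qed

lemma Frobenius_notin: "finite (- H) \<Longrightarrow> Frobenius H \<notin> int ` H"
  using ex_Frobenius Frobenius_eqI by metis

lemma greater_Frobenius_in: "finite (- H) \<Longrightarrow> z > Frobenius H \<Longrightarrow> z \<in> int ` H"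
  using ex_Frobenius Frobenius_eqI by metis

lemma Frobenius_ge: "finite (- H) \<Longrightarrow> Frobenius H \<ge> -1"
  using greater_Frobenius_in[of H "-1"] by force

lemma add_submonoid_int_add:
  assumes "add_submonoid M" "u \<in> int ` M" "v \<in> int ` M"
  shows "u + v \<in> int ` M"
  using assms unfolding add_submonoid_def by (metis (no_types, lifting) imageE image_eqI of_nat_add)

lemma add_submonoid_int_mult:
  assumes "add_submonoid M" "u \<in> int ` M"
  shows "int k * u \<in> int ` M"
proof (induction k)
  case 0
  show ?case using assms(1) unfolding add_submonoid_def by force
next
  case (Suc k)
  then have "u + int k * u \<in> int ` M" by (rule add_submonoid_int_add[OF assms])
  then show ?case by (simp add: algebra_simps)
qed

section \<open>Unpaired gaps and almost symmetry\<close>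

definition unpaired_gaps :: "nat set \<Rightarrow> int set" where
  "unpaired_gaps H = {z. z \<notin> int ` H \<and> Frobenius H - z \<notin> int ` H}"

lemma genus_unpaired_gaps:
  assumes "numerical_semigroup H"
  shows "finite (unpaired_gaps H)"
    and "2 * int (genus H) = Frobenius H + 1 + int (card (unpaired_gaps H))"
proof -
  have fin: "finite (- H)" and sub: "add_submonoid H"
    using assms by (auto simp: numerical_semigroup_def)
  define F where "F = Frobenius H"
  define G where "G = int ` (- H)"
  let ?R = "(\<lambda>z. F - z) ` G"
  have G: "z \<in> G \<longleftrightarrow> 0 \<le> z \<and> z \<notin> int ` H" for z
    unfolding G_def by (cases z) auto
  have Fn: "F \<notin> int ` H" and Fg: "\<And>z. z > F \<Longrightarrow> z \<in> int ` H" and F1: "F \<ge> -1"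
    using fin Frobenius_notin greater_Frobenius_in Frobenius_ge unfolding F_def by auto
  have R: "z \<in> ?R \<longleftrightarrow> F - z \<in> G" for z
    by (auto simp: image_iff intro: bexI[of _ "F - z"])
  have finG: "finite G" using fin by (simp add: G_def)
  have card_R: "card ?R = card G" by (intro card_image inj_onI) auto
  have le: "z \<le> F" if "z \<notin> int ` H" for z
    using Fg[of z] that by force
  \<comment> \<open>Unpaired gaps cannot be negative: \<open>le\<close> applied to
    \<open>F - z\<close> yields \<open>0 \<le> z\<close>.\<close>
  have inter: "G \<inter> ?R = unpaired_gaps H"
    using le by (force simp: G R unpaired_gaps_def F_def[symmetric])
  have union: "G \<union> ?R = {0..F}"
  proof (intro set_eqI iffI)
    fix z assume "z \<in> G \<union> ?R"
    then show "z \<in> {0..F}" using le[of z] le[of "F - z"] by (auto simp: G R)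
  next
    fix z assume z: "z \<in> {0..F}"
    show "z \<in> G \<union> ?R"
      \<comment> \<open>If \<open>z\<close> and \<open>F - z\<close> were both in \<open>H\<close>,
        so would be their sum \<open>F\<close>.\<close>
      using add_submonoid_int_add[OF sub, of z "F - z"] Fn z unfolding Un_iff R G by auto
  qed
  show "finite (unpaired_gaps H)" using finG inter by (metis finite_Int)
  have "card G + card ?R = card {0..F} + card (unpaired_gaps H)"
    using card_Un_Int[of G ?R] finG union inter by simp
  moreover have "card G = genus H" by (simp add: G_def genus_def card_image)
  ultimately show "2 * int (genus H) = Frobenius H + 1 + int (card (unpaired_gaps H))"
    using card_R F1 by (simp add: F_def)
qed

lemma not_symmetric_unpaired_gap:
  assumes "numerical_semigroup H" "\<not> symmetric H"
  obtains a where "a \<in> unpaired_gaps H"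
  using assms genus_unpaired_gaps[OF assms(1)] unfolding symmetric_def by fastforce

lemma almost_symmetric_unpaired_gaps_PF:
  assumes H: "numerical_semigroup H" and "almost_symmetric H"
  shows "unpaired_gaps H \<subseteq> PF H"
proof -
  have fin: "finite (- H)" using H by (simp add: numerical_semigroup_def)
  define F where "F = Frobenius H"
  note L = genus_unpaired_gaps[OF H]
  have Fn: "F \<notin> int ` H" and Fg: "\<And>z. z > F \<Longrightarrow> z \<in> int ` H"
    using fin Frobenius_notin greater_Frobenius_in unfolding F_def by auto
  have FPF: "F \<in> PF H" using Fn Fg by (auto simp: PF_def)
  have sub: "PF H - {F} \<subseteq> unpaired_gaps H"
  proof
    fix f assume "f \<in> PF H - {F}"
    then have f: "f \<notin> int ` H" "f \<noteq> F" "\<And>h. h \<in> H \<Longrightarrow> h \<noteq> 0 \<Longrightarrow> f + int h \<in> int ` H"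
      by (auto simp: PF_def)
    \<comment> \<open>Otherwise \<open>F - f\<close> is a nonzero element of \<open>H\<close>, and
      adding it to the pseudo-Frobenius number \<open>f\<close> puts \<open>F\<close> in
      \<open>H\<close>.\<close>
    have "F - f \<notin> int ` H"
    proof
      assume "F - f \<in> int ` H"
      then obtain h where "h \<in> H" "F - f = int h" by auto
      with f(2) f(3)[of h] Fn show False by (cases "h = 0") (auto simp: algebra_simps)
    qed
    with f(1) show "f \<in> unpaired_gaps H" by (simp add: unpaired_gaps_def F_def)
  qed
  then have "PF H \<subseteq> insert F (unpaired_gaps H)" by auto
  then have "finite (PF H)" using L(1) by (simp add: finite_subset)
  then have "card (PF H) = Suc (card (PF H - {F}))" using FPF by (rule card.remove)
  \<comment> \<open>Almost symmetry turns the genus count into \<open>t(H) - 1 = |L(H)|\<close>, so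
    the inclusion \<open>sub\<close> of finite sets is an equality.\<close>
  then have "card (PF H - {F}) = card (unpaired_gaps H)"
    using L(2) assms(2) by (simp add: almost_symmetric_def semigroup_type_def)
  then have "PF H - {F} = unpaired_gaps H" using card_subset_eq[OF L(1) sub] by simp
  then show ?thesis by blast
qed

section \<open>Gluings\<close>

lemma generated_glue:
  assumes "add_submonoid M" "add_submonoid N"
  shows "generated ((*) x ` M \<union> (*) y ` N) = {x * a + y * b | a b. a \<in> M \<and> b \<in> N}"
    (is "_ = ?S")
  unfolding generated_def
proof (rule hull_unique)
  have 0: "0 \<in> M" "0 \<in> N" using assms by (auto simp: add_submonoid_def)
  show "(*) x ` M \<union> (*) y ` N \<subseteq> ?S"
    proof
    fix z assume "z \<in> (*) x ` M \<union> (*) y ` N"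
    then obtain a b where "a \<in> M" "b \<in> N" "z = x * a + y * b"
      using 0 by (metis Un_iff add_0_right add_0 image_iff mult_0_right)
    then show "z \<in> ?S" by blast
  qed
  show "add_submonoid ?S"
    unfolding add_submonoid_def
  proof (intro conjI ballI)
    show "0 \<in> ?S" using 0 by force
    fix s t assume "s \<in> ?S" "t \<in> ?S"
    then obtain a b c d where
      "s = x * a + y * b" "t = x * c + y * d" "a \<in> M" "b \<in> N" "c \<in> M" "d \<in> N" by auto
    then have "s + t = x * (a + c) + y * (b + d)" "a + c \<in> M" "b + d \<in> N"
      using assms by (simp_all add: add_submonoid_def algebra_simps)
    then show "s + t \<in> ?S" by blast
  qed
  fix T assume T: "(*) x ` M \<union> (*) y ` N \<subseteq> T" "add_submonoid T"
  then show "?S \<subseteq> T" unfolding add_submonoid_def by blast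
qed

text \<open>The naturals other than 1 form a submonoid, since a sum equal to 1 has a summand
  1.\<close>

lemma one_in_generators:
  assumes "1 \<in> generated A"
  shows "1 \<in> A"
proof (rule ccontr)
  assume "1 \<notin> A"
  then have "generated A \<subseteq> - {1}"
    unfolding generated_def by (intro hull_minimal) (auto simp: add_submonoid_def)
  with assms show False by auto
qed

lemma is_gluing_sym:
  assumes "is_gluing H x H1 y H2"
  shows "is_gluing H y H2 x H1"
  using assms unfolding is_gluing_def by (metis Un_commute gcd.commute)

text \<open>Neither factor is 1, because 1 belongs to every generating set of a semigroup containing
  it; and \<open>x = 0\<close> would force \<open>y = 1\<close> by coprimality.\<close>

lemma is_gluing_gt_1:
  assumes "is_gluing H x H1 y H2"
  shows "x > 1"
proof -
  obtain A B where AB: "generated A = H1" "generated B = H2" "y \<in> H1 - A" "x \<in> H2 - B"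
    and g: "gcd x y = 1"
    using assms unfolding is_gluing_def minimal_generators_def by (elim conjE exE) (rule that)
  have "y \<noteq> 1" "x \<noteq> 1" using AB one_in_generators by auto
  moreover have "x \<noteq> 0" using \<open>y \<noteq> 1\<close> g by (metis gcd_0_left_nat)
  ultimately show ?thesis by linarith
qed

lemma not_almost_symmetric_gluing:
  assumes nonsym: "\<not> symmetric H1" and gl: "is_gluing H x H1 y H2"
  shows "\<not> almost_symmetric H"
proof
  assume almost: "almost_symmetric H"
  have x: "x > 1" and y: "y > 1" using gl is_gluing_gt_1 is_gluing_sym by blast+
  have S1: "numerical_semigroup H1" and S2: "numerical_semigroup H2"
    and xH2: "x \<in> H2" and yH1: "y \<in> H1" and cop: "coprime (int x) (int y)"
    and H_gen: "H = generated ((*) x ` H1 \<union> (*) y ` H2)"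
    using gl unfolding is_gluing_def by (auto simp: coprime_iff_gcd_eq_1)
  then have M1: "add_submonoid H1" and M2: "add_submonoid H2"
    and fin1: "finite (- H1)" and fin2: "finite (- H2)"
    by (auto simp: numerical_semigroup_def)
  have H_eq: "H = {x * a + y * b | a b. a \<in> H1 \<and> b \<in> H2}"
    using H_gen generated_glue[OF M1 M2] by simp
  have HI: "int x * u + int y * v \<in> int ` H" if uv: "u \<in> int ` H1" "v \<in> int ` H2" for u v
  proof -
    obtain a b where "u = int a" "a \<in> H1" "v = int b" "b \<in> H2" using uv by auto
    then show ?thesis unfolding H_eq by (intro image_eqI[of _ _ "x * a + y * b"]) auto
  qed
  \<comment> \<open>By coprimality, \<open>(u, w)\<close> differs from a representation
    \<open>(a, b)\<close> over \<open>H1\<close> and \<open>H2\<close> by \<open>k\<close> times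
    \<open>(y, -x)\<close>. The condition on \<open>w\<close> excludes \<open>k < 0\<close>, hence
    \<open>u = a + k y\<close> is in \<open>H1\<close>.\<close>
  have key: "u \<in> int ` H1"
    if mem: "int x * u + int y * w \<in> int ` H" and w: "w - int x \<notin> int ` H2" for u w
  proof -
    obtain a b where ab: "a \<in> H1" "b \<in> H2" "int x * u + int y * w = int x * int a + int y * int b"
      using mem unfolding H_eq by auto
    then have "int x * (u - int a) = int y * (int b - w)" by (simp add: algebra_simps)
    moreover from this have "int x dvd int b - w"
      using cop by (metis coprime_dvd_mult_right_iff dvd_triv_left)
    then obtain k where k: "int b - w = int x * k" by blast
    ultimately have "int x * (u - int a) = int x * (int y * k)" by simp
    then have u: "u = int a + int y * k" using x by simp
    have "k \<ge> 0"
    proof (rule ccontr)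
      assume "\<not> k \<ge> 0"
      \<comment> \<open>Here \<open>w = b - k x\<close>; subtracting one more \<open>x\<close>
        leaves the coefficient \<open>-k - 1\<close>, which is still nonnegative for
        \<open>k < 0\<close>.\<close>
      then have "w - int x = int b + int (nat (-k - 1)) * int x"
        using k by (simp add: algebra_simps)
      also have "\<dots> \<in> int ` H2"
        using ab(2) xH2 by (intro add_submonoid_int_add add_submonoid_int_mult M2) auto
      finally show False using w by simp
    qed
    then have "u = int a + int (nat k) * int y" using u by simp
    also have "\<dots> \<in> int ` H1"
      using ab(1) yH1 by (intro add_submonoid_int_add add_submonoid_int_mult M1) auto
    finally show ?thesis .
  qed
  define F1 where "F1 = Frobenius H1"
  \<comment> \<open>The largest integer whose translate by \<open>-x\<close> is outside
    \<open>H2\<close>; it lies in \<open>H2\<close> itself as \<open>x > 0\<close>.\<close>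
  define w where "w = Frobenius H2 + int x"
  have w_pos: "w > 0" using Frobenius_ge[OF fin2] x by (simp add: w_def)
  have w_notin: "w - int x \<notin> int ` H2" using Frobenius_notin[OF fin2] by (simp add: w_def)
  have w_in: "w \<in> int ` H2" using greater_Frobenius_in[OF fin2] x by (simp add: w_def)
  define F where "F = int x * F1 + int y * w"
  have F_notin: "F \<notin> int ` H"
    using key[OF _ w_notin] Frobenius_notin[OF fin1] unfolding F_def F1_def by blast
  have F_greater: "z \<in> int ` H" if z: "z > F" for z
  proof -
    obtain c d where cd: "c * int x + d * int y = 1"
      using cop by (metis bezout_int coprime_imp_gcd_eq_1)
    \<comment> \<open>The representative of \<open>d z\<close> modulo \<open>x\<close> in the window
      from \<open>w - x + 1\<close> to \<open>w\<close>. It exceeds \<open>Frobenius H2\<close>, and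
      \<open>y v\<close> is congruent to \<open>z\<close> modulo \<open>x\<close> by the Bezout
      identity.\<close>
    define v where "v = w - (w - d * z) mod int x"
    have v: "v \<le> w" "v > w - int x"
      using x by (auto simp: v_def)
    have vH: "v \<in> int ` H2" using v greater_Frobenius_in[OF fin2] by (simp add: w_def)
    have "int x dvd v - d * z"
      unfolding v_def by (metis diff_right_commute dvd_minus_mod)
    then have "int x dvd int y * (v - d * z) - (c * z) * int x"
      by (meson dvd_diff dvd_mult dvd_triv_right)
    also have "int y * (v - d * z) - (c * z) * int x = int y * v - (c * int x + d * int y) * z"
      by (simp add: algebra_simps)
    also have "\<dots> = - (z - int y * v)" using cd by simp
    finally obtain u where u: "z - int y * v = int x * u" unfolding dvd_minus_iff by blast
    \<comment> \<open>The upper end of the window matters here: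
      \<open>x u = z - y v > F - y w = x F1\<close>.\<close>
    have "int y * v \<le> int y * w" using v by (intro mult_left_mono) auto
    then have "int x * F1 < int x * u" using u z by (simp add: F_def)
    then have "u > F1" using x by simp
    then have "u \<in> int ` H1" using greater_Frobenius_in[OF fin1] by (simp add: F1_def)
    then show ?thesis using HI[OF _ vH] u by (metis diff_add_cancel)
  qed
  have FH: "Frobenius H = F" using F_notin F_greater by (rule Frobenius_eqI)
  have "- H \<subseteq> nat ` {0..F}"
  proof
    fix n assume "n \<in> - H"
    then have "int n \<le> F" using F_greater[of "int n"] by force
    then show "n \<in> nat ` {0..F}" by (intro image_eqI[of _ _ "int n"]) auto
  qed
  then have "finite (- H)" by (rule finite_subset) simp
  moreover have "add_submonoid H"
    unfolding H_gen generated_def by (rule hull_in) (auto simp: add_submonoid_def)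
  ultimately have SH: "numerical_semigroup H" by (simp add: numerical_semigroup_def)
  obtain a where a: "a \<notin> int ` H1" "F1 - a \<notin> int ` H1"
    by (rule not_symmetric_unpaired_gap[OF S1 nonsym]) (auto simp: unpaired_gaps_def F1_def)
  \<comment> \<open>This allows \<open>key\<close> with second coordinate 0.\<close>
  have "- int x \<notin> int ` H2" using x by auto
  then have "int x * a \<notin> int ` H" using key[of a 0] a by auto
  \<comment> \<open>The difference is \<open>x (F1 - a) + y w\<close>, again of the form treated by
    \<open>key\<close>.\<close>
  moreover have "F - int x * a \<notin> int ` H"
    using key[OF _ w_notin, of "F1 - a"] a by (auto simp: F_def algebra_simps)
  ultimately have "int x * a \<in> PF H"
    using almost_symmetric_unpaired_gaps_PF[OF SH almost] FH by (auto simp: unpaired_gaps_def)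
  moreover have "0 \<in> int ` H1" using M1 by (force simp: add_submonoid_def)
  then have "int y * w \<in> int ` H" using HI[OF _ w_in, of 0] by simp
  then obtain h where h: "h \<in> H" "int y * w = int h" by auto
  moreover have "int y * w > 0" using y w_pos by simp
  then have "h \<noteq> 0" using h(2) by auto
  ultimately have "int x * a + int y * w \<in> int ` H" by (auto simp: PF_def)
  then show False using key w_notin a(1) by blast
qed

theorem theorem6p7:
  fixes H1 H2 H :: "nat set" and x y :: nat
  assumes "numerical_semigroup H1"
    and "numerical_semigroup H2"
    and "\<not> symmetric H1 \<or> \<not> symmetric H2"
    and "is_gluing H x H1 y H2"
  shows "\<not> almost_symmetric H"
  using assms not_almost_symmetric_gluing is_gluing_sym by blast

end
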